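(* Let $q$ be an odd prime power, $d=q-1$, and let $\phi\in\mathbb R^{\mathbb F_q^\times}$ be a unit vector. Put $X_\phi=\sum_{m\in\mathbb F_q^\times}|\phi(m)|^4$. Then $$\sigma_{\min}(\mathcal M_\phi)^2\le q\min\left\{\frac{dX_\phi-1}{d-1},\frac{1-X_\phi}{d-1}\right\}.$$ Moreover, $$\min\left\{\frac{dX_\phi-1}{d-1},\frac{1-X_\phi}{d-1}\right\}\le\frac1q,\qquad\text{and hence}\qquad\sigma_{\min}(\mathcal M_\phi)^2\le1.$$ Consequently, if $q=p^h$ with $p$ an odd prime, $h\ge2$ and $d\ge10$, then the optimal two-level orbit, generated by $\phi_{q,r}$ with $r=1+\sqrt d$, is within the explicit factor $$\frac{\sqrt d+1}{\sqrt q\,\sin(\pi/(2p))}$$ of the best possible stability among all real unit generating vectors, i.e. $\sup_{\phi}\sigma_{\min}(\mathcal M_\phi)\le\frac{\sqrt d+1}{\sqrt q\sin(\pi/(2p))}\,\sigma_{\min}(\mathcal M_{\phi_{q,1+\sqrt d}})$, the supremum being over real unit vectors $\phi\in\mathbb R^{\mathbb F_q^\times}$. For every fixed odd $p$, this factor is bounded independently of $h$.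
   Context: $G_q=\mathbb F_q\rtimes\mathbb F_q^\times$ is the affine group with product $(k,l)(k',l')=(k+lk',ll')$, acting on $\mathbb C^{\mathbb F_q^\times}$ by the unitary representation $(\pi_q(k,l)f)(m)=\psi(km)f(lm)$, where $\psi$ is any fixed nontrivial additive character of $\mathbb F_q$. For a vector $\phi$, $\mathcal M_\phi:\mathbb C^{\mathbb F_q^\times\times\mathbb F_q^\times}\to\mathbb C^{G_q}$ is the linear map $\mathcal M_\phi(A)(g)=\langle A\pi_q(g)\phi,\pi_q(g)\phi\rangle$, and $\sigma_{\min}(\mathcal M_\phi)=\min_{A\ne0}\|\mathcal M_\phi(A)\|_{\ell^2(G_q)}/\|A\|_F$ (Frobenius norm; counting measure on $G_q$). The two-level windows are $\phi_{q,r}(1)=r/\sqrt{d-1+r^2}$, $\phi_{q,r}(m)=1/\sqrt{d-1+r^2}$ for $m\ne1$, with $r\ge0$; "optimal" means maximizing $\sigma_{\min}(\mathcal M_{\phi_{q,r}})$ over $r\ge0$. *)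

theory Defs
  imports "HOL-Analysis.Analysis" "HOL-Algebra.Group" "HOL-Computational_Algebra.Primes"
begin

section \<open>The multiplicative group of a field as an index type\<close>

text \<open>
  A finite field with \<open>q\<close> elements is a type \<open>'a :: {field, finite}\<close> with \<open>CARD('a) = q\<close>.
  The type \<open>'a nz\<close> of its nonzero elements indexes the vectors and matrices below, so that the
  library norms on \<open>complex ^ 'a nz\<close> and \<open>complex ^ 'a nz ^ 'a nz\<close> are the Euclidean norm and the
  Frobenius norm.
\<close>

typedef (overloaded) ('a :: field) nz = "{x :: 'a. x \<noteq> 0}"
  morphisms of_nz to_nz
  by (rule exI [of _ 1]) simp

lemma of_nz_nonzero [simp]: "of_nz x \<noteq> 0"
  using of_nz [of x] by simp

lemma of_nz_to_nz [simp]: "x \<noteq> 0 \<Longrightarrow> of_nz (to_nz x) = x"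
  by (rule to_nz_inverse) simp

lemma nz_eq_iff: "x = y \<longleftrightarrow> of_nz x = of_nz y"
  by (simp add: of_nz_inject)

instance nz :: ("{field, finite}") finite
proof
  have "inj (of_nz :: 'a nz \<Rightarrow> 'a)"
    by (simp add: inj_def of_nz_inject)
  then show "finite (UNIV :: 'a nz set)"
    by (rule finite_imageD [rotated]) simp
qed

instantiation nz :: (field) comm_monoid_mult
begin

definition one_nz :: "'a nz" where "1 = to_nz 1"

definition times_nz :: "'a nz \<Rightarrow> 'a nz \<Rightarrow> 'a nz" where
  "x * y = to_nz (of_nz x * of_nz y)"

instance
  by standard (simp_all add: nz_eq_iff one_nz_def times_nz_def mult_ac)

end

lemma of_nz_one [simp]: "of_nz 1 = 1"
  by (simp add: one_nz_def)

lemma of_nz_mult [simp]: "of_nz (x * y) = of_nz x * of_nz y"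
  by (simp add: times_nz_def)

lemma card_nz: "CARD('a :: {field, finite} nz) = CARD('a) - 1"
proof -
  have "card (of_nz ` (UNIV :: 'a nz set)) = CARD('a nz)"
    by (rule card_image) (simp add: inj_on_def of_nz_inject)
  moreover have "of_nz ` (UNIV :: 'a nz set) = UNIV - {0}"
    unfolding type_definition.Rep_range [OF type_definition_nz] by (simp add: set_eq_iff)
  ultimately show ?thesis
    by simp
qed


section \<open>The affine group and its representation\<close>

definition affine_group :: "('a :: field \<times> 'a nz) monoid" where
  "affine_group = \<lparr>carrier = UNIV,
     mult = (\<lambda>(k, l) (k', l'). (k + of_nz l * k', l * l')),
     one = (0, 1)\<rparr>"

lemma affine_group_simps [simp]:
  "carrier affine_group = UNIV"
  "\<one>\<^bsub>affine_group\<^esub> = (0, 1)"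
  "(k, l) \<otimes>\<^bsub>affine_group\<^esub> (k', l') = (k + of_nz l * k', l * l')"
  by (simp_all add: affine_group_def)

lemma group_affine_group: "group (affine_group :: ('a :: field \<times> 'a nz) monoid)"
proof (rule groupI)
  fix x :: "'a \<times> 'a nz"
  obtain k l where x: "x = (k, l)" by fastforce
  let ?l = "to_nz (inverse (of_nz l))"
  have "(- (of_nz ?l * k), ?l) \<otimes>\<^bsub>affine_group\<^esub> x = \<one>\<^bsub>affine_group\<^esub>"
    unfolding x affine_group_simps by (simp add: nz_eq_iff)
  then show "\<exists>y\<in>carrier affine_group. y \<otimes>\<^bsub>affine_group\<^esub> x = \<one>\<^bsub>affine_group\<^esub>"
    unfolding affine_group_simps(1) by blast
qed (auto simp: distrib_left mult.assoc add.assoc)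

definition additive_character :: "('a :: field \<Rightarrow> complex) \<Rightarrow> bool" where
  "additive_character \<psi> \<longleftrightarrow> (\<forall>x y. \<psi> (x + y) = \<psi> x * \<psi> y) \<and> (\<forall>x. cmod (\<psi> x) = 1)"

definition nontrivial_additive_character :: "('a :: field \<Rightarrow> complex) \<Rightarrow> bool" where
  "nontrivial_additive_character \<psi> \<longleftrightarrow> additive_character \<psi> \<and> (\<exists>x. \<psi> x \<noteq> 1)"

definition affine_rep ::
  "('a \<Rightarrow> complex) \<Rightarrow> 'a :: {field, finite} \<times> 'a nz \<Rightarrow> complex ^ 'a nz \<Rightarrow> complex ^ 'a nz" where
  "affine_rep \<psi> g f = (\<chi> m. \<psi> (fst g * of_nz m) * f $ (snd g * m))"

definition hermitian :: "complex ^ 'n \<Rightarrow> complex ^ 'n \<Rightarrow> complex" where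
  "hermitian u v = (\<Sum>m\<in>UNIV. u $ m * cnj (v $ m))"

lemma affine_rep_mult:
  assumes "additive_character \<psi>"
  shows "affine_rep \<psi> (g \<otimes>\<^bsub>affine_group\<^esub> h) f = affine_rep \<psi> g (affine_rep \<psi> h f)"
  using assms
  by (cases g; cases h)
     (simp add: affine_rep_def additive_character_def vec_eq_iff algebra_simps)

lemma affine_rep_unitary:
  assumes "additive_character \<psi>"
  shows "hermitian (affine_rep \<psi> g u) (affine_rep \<psi> g v) = hermitian u v"
proof -
  have unit: "\<psi> x * cnj (\<psi> x) = 1" for x
    using assms by (simp add: additive_character_def flip: complex_norm_square)
  have "inj ((*) (snd g))"
    by (simp add: inj_def nz_eq_iff)
  then have bij: "bij ((*) (snd g))"
    by (simp add: bij_def finite_UNIV_inj_surj)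
  have "hermitian (affine_rep \<psi> g u) (affine_rep \<psi> g v) =
      (\<Sum>m\<in>UNIV. (\<psi> (fst g * of_nz m) * cnj (\<psi> (fst g * of_nz m))) *
        (u $ (snd g * m) * cnj (v $ (snd g * m))))"
    by (simp add: hermitian_def affine_rep_def mult_ac)
  also have "\<dots> = (\<Sum>m\<in>UNIV. u $ (snd g * m) * cnj (v $ (snd g * m)))"
    by (simp only: unit mult_1_left)
  also have "\<dots> = hermitian u v"
    unfolding hermitian_def
    by (rule sum.reindex_bij_betw [OF bij, of "\<lambda>m. u $ m * cnj (v $ m)"])
  finally show ?thesis .
qed


section \<open>The measurement map and its stability constant\<close>

definition measurement_map ::
  "('a :: {field, finite} \<Rightarrow> complex) \<Rightarrow> complex ^ 'a nz \<Rightarrow>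
    complex ^ 'a nz ^ 'a nz \<Rightarrow> complex ^ ('a \<times> 'a nz)" where
  "measurement_map \<psi> \<phi> A =
     (\<chi> g. hermitian (A *v affine_rep \<psi> g \<phi>) (affine_rep \<psi> g \<phi>))"

definition sigma_min :: "('v :: real_normed_vector \<Rightarrow> 'w :: real_normed_vector) \<Rightarrow> real" where
  "sigma_min T = (INF A\<in>{A. A \<noteq> 0}. norm (T A) / norm A)"

text \<open>For a linear map on a nonzero Euclidean space, the infimum is a minimum.\<close>

lemma sigma_min_attained:
  fixes T :: "'v :: euclidean_space \<Rightarrow> 'w :: real_normed_vector"
  assumes "linear T"
  shows "\<exists>A. A \<noteq> 0 \<and> sigma_min T = norm (T A) / norm A"
    and "A \<noteq> 0 \<Longrightarrow> sigma_min T \<le> norm (T A) / norm A"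
proof -
  have bdd: "bdd_below ((\<lambda>A. norm (T A) / norm A) ` {A. A \<noteq> 0})"
    by (rule bdd_belowI2 [of _ 0]) simp
  then show le: "A \<noteq> 0 \<Longrightarrow> sigma_min T \<le> norm (T A) / norm A" for A
    unfolding sigma_min_def by (rule cINF_lower) simp
  have "continuous_on (sphere 0 1) (\<lambda>A. norm (T A))"
    by (intro continuous_on_norm linear_continuous_on linear_conv_bounded_linear [THEN iffD1] assms)
  moreover have "sphere 0 1 \<noteq> ({} :: 'v set)"
    by simp
  ultimately have "\<exists>B\<in>sphere 0 1. \<forall>A\<in>sphere 0 1. norm (T B) \<le> norm (T A)"
    by (rule continuous_attains_inf [OF compact_sphere, rotated])
  then obtain B where B: "B \<in> sphere 0 1" "\<And>A. A \<in> sphere 0 1 \<Longrightarrow> norm (T B) \<le> norm (T A)"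
    by blast
  have "norm (T B) / norm B \<le> norm (T A) / norm A" if "A \<noteq> 0" for A
    using B(2) [of "A /\<^sub>R norm A"] B(1) that assms
    by (simp add: linear_scale divide_inverse mult.commute)
  then have "norm (T B) / norm B \<le> sigma_min T"
    unfolding sigma_min_def using B(1) by (intro cINF_greatest) auto
  moreover have "B \<noteq> 0"
    using B(1) by auto
  ultimately show "\<exists>A. A \<noteq> 0 \<and> sigma_min T = norm (T A) / norm A"
    using le [of B] by (intro exI [of _ B] conjI antisym) auto
qed

lemma linear_measurement_map: "linear (measurement_map \<psi> \<phi>)"
proof (rule linearI)
  fix A B :: "complex ^ 'a nz ^ 'a nz" and c :: real
  show "measurement_map \<psi> \<phi> (A + B) = measurement_map \<psi> \<phi> A + measurement_map \<psi> \<phi> B"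
    by (simp add: measurement_map_def hermitian_def vec_eq_iff matrix_vector_mult_add_rdistrib
        distrib_right sum.distrib)
  show "measurement_map \<psi> \<phi> (c *\<^sub>R A) = c *\<^sub>R measurement_map \<psi> \<phi> A"
    by (simp add: measurement_map_def hermitian_def vec_eq_iff matrix_vector_mult_def
        scaleR_sum_right sum_distrib_right)
qed

definition complex_vec :: "real ^ 'n \<Rightarrow> complex ^ 'n" where
  "complex_vec \<phi> = (\<chi> m. complex_of_real (\<phi> $ m))"

definition stability :: "('a :: {field, finite} \<Rightarrow> complex) \<Rightarrow> real ^ 'a nz \<Rightarrow> real" where
  "stability \<psi> \<phi> = sigma_min (measurement_map \<psi> (complex_vec \<phi>))"

definition fourth_moment :: "real ^ 'n \<Rightarrow> real" where
  "fourth_moment \<phi> = (\<Sum>m\<in>UNIV. \<bar>\<phi> $ m\<bar> ^ 4)"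

text \<open>Here \<open>CARD('a nz)\<close> is \<open>d = q - 1\<close>, see \<open>card_nz\<close>.\<close>

definition two_level :: "real \<Rightarrow> real ^ 'a :: {field, finite} nz" where
  "two_level r = (let c = sqrt (real CARD('a nz) - 1 + r\<^sup>2) in
     (\<chi> m. if m = 1 then r / c else 1 / c))"

definition optimality_factor :: "nat \<Rightarrow> nat \<Rightarrow> real" where
  "optimality_factor p q = (sqrt (real q - 1) + 1) / (sqrt (real q) * sin (pi / (2 * real p)))"

end

(* Parseval in the translation parameter k splits |M(A)|^2 into independent contributions of the
   diagonals n - m = t of A. Evaluating at one diagonal matrix, and averaging over the off-diagonal
   matrix units, gives the two bounds in terms of X.
   For a two-level window, the block of a diagonal t \<noteq> 0 is a rank-one matrix plus (r - 1) times the
   vertex-edge incidence matrix of the cycles of the translation by t. These cycles have odd length p,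
   so the smallest singular value of the incidence matrix is 2 sin(pi/(2p)), and the rank-one part
   only increases the norm when r \<ge> 1. It remains to maximise |r - 1|/(d - 1 + r^2). *)

theory Submission
  imports Defs "HOL-Number_Theory.Cong"
begin

section \<open>Additive characters\<close>

text \<open>Indices run over nonzero elements only, so the cycle through \<open>0\<close> is cut
  open there. Extending \<open>A\<close> by zero closes it again, with label \<open>0\<close> on the
  edges at the missing vertex, and every diagonal becomes a function on the whole additive group. No
  cycle then needs separate treatment: the map from \<open>a x\<close> to
  \<open>a x + a (x - t)\<close> multiplies the \<open>k\<close>-th Fourier coefficient by
  \<open>1 + \<psi> (k * t)\<close>, and \<open>\<psi> (k * t)\<close> is a \<open>p\<close>-th root
  of unity. The price is paid in the converse bound, where the extremal labelling must vanish on the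
  edges at \<open>0\<close>. This is possible because \<open>q > p\<close> leaves cycles that avoid
  \<open>0\<close>, whence \<open>h \<ge> 2\<close>. The size of \<open>d\<close> is needed to
  exclude windows with \<open>r < 1\<close>. The comparison factor is the reciprocal of the optimal
  two-level stability, since all other windows enter only through the bound
  \<open>1\<close>.\<close>

lemma additive_character_0: "additive_character \<psi> \<Longrightarrow> \<psi> 0 = 1"
proof -
  assume \<psi>: "additive_character \<psi>"
  then have "\<psi> (0 + 0) = \<psi> 0 * \<psi> 0" "cmod (\<psi> 0) = 1"
    unfolding additive_character_def by blast+
  moreover from this have "\<psi> 0 \<noteq> 0" by auto
  ultimately show ?thesis by simp
qed

lemma cnj_additive_character:
  assumes "additive_character \<psi>"
  shows "cnj (\<psi> x) = \<psi> (- x)"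
proof -
  have "\<psi> x * \<psi> (- x) = \<psi> (x + - x)"
    using assms unfolding additive_character_def by metis
  also have "\<dots> = 1"
    using additive_character_0 [OF assms] by simp
  finally have 1: "\<psi> x * \<psi> (- x) = 1" .
  have "\<psi> x * cnj (\<psi> x) = 1"
    using assms by (simp add: additive_character_def flip: complex_norm_square)
  with 1 show ?thesis
    by (metis mult.left_commute mult.right_neutral)
qed

lemma additive_character_of_nat:
  assumes "additive_character \<psi>"
  shows "\<psi> (of_nat n * x) = \<psi> x ^ n"
  using assms
  by (induction n) (auto simp: additive_character_0 additive_character_def distrib_right)

lemma sum_additive_character:
  fixes \<psi> :: "'a :: {field, finite} \<Rightarrow> complex"
  assumes "nontrivial_additive_character \<psi>"
  shows "(\<Sum>k\<in>UNIV. \<psi> (k * y)) = (if y = 0 then of_nat CARD('a) else 0)"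
proof (cases "y = 0")
  case True
  then show ?thesis
    using assms additive_character_0 by (auto simp: nontrivial_additive_character_def)
next
  case False
  from assms obtain x0 where x0: "\<psi> x0 \<noteq> 1" and ch: "additive_character \<psi>"
    by (auto simp: nontrivial_additive_character_def)
  \<comment> \<open>The shift by \<open>x0 / y\<close> permutes the field and multiplies the sum by
    \<open>\<psi> x0\<close>, which is not \<open>1\<close>.\<close>
  have "(\<Sum>k\<in>UNIV. \<psi> (k * y)) = (\<Sum>k\<in>UNIV. \<psi> ((k + x0 / y) * y))"
    by (rule sum.reindex_bij_betw [symmetric], rule bij_betwI [of _ _ _ "\<lambda>k. k - x0 / y"]) auto
  also have "\<dots> = (\<Sum>k\<in>UNIV. \<psi> (k * y)) * \<psi> x0"
    using False ch by (simp add: distrib_right additive_character_def sum_distrib_right)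
  finally show ?thesis
    using x0 False by simp
qed

text \<open>A single nontrivial \<open>\<psi>\<close> suffices: its dilates
  \<open>\<psi> (k * x)\<close> are orthogonal, so after summing over \<open>k\<close> only the
  terms with \<open>x = y\<close> of the expanded square survive.\<close>

lemma parseval_additive_character:
  fixes \<psi> :: "'a :: {field, finite} \<Rightarrow> complex"
  assumes "nontrivial_additive_character \<psi>"
  shows "(\<Sum>k\<in>UNIV. (cmod (\<Sum>x\<in>UNIV. a x * \<psi> (k * x)))\<^sup>2) = real CARD('a) * (\<Sum>x\<in>UNIV. (cmod (a x))\<^sup>2)"
proof -
  have ch: "additive_character \<psi>"
    using assms by (simp add: nontrivial_additive_character_def)
  have prod: "\<psi> (k * x) * cnj (\<psi> (k * y)) = \<psi> (k * (x - y))" for k x y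
  proof -
    have "\<psi> (k * x) * \<psi> (- (k * y)) = \<psi> (k * x + - (k * y))"
      using ch unfolding additive_character_def by metis
    then show ?thesis
      by (simp add: cnj_additive_character [OF ch] right_diff_distrib)
  qed
  have "complex_of_real (\<Sum>k\<in>UNIV. (cmod (\<Sum>x\<in>UNIV. a x * \<psi> (k * x)))\<^sup>2)
      = (\<Sum>k\<in>UNIV. \<Sum>x\<in>UNIV. \<Sum>y\<in>UNIV. (a x * cnj (a y)) * (\<psi> (k * x) * cnj (\<psi> (k * y))))"
    by (simp only: of_real_sum complex_norm_square cnj_sum sum_product complex_cnj_mult mult_ac)
  also have "\<dots> = (\<Sum>k\<in>UNIV. \<Sum>x\<in>UNIV. \<Sum>y\<in>UNIV. (a x * cnj (a y)) * \<psi> (k * (x - y)))"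
    by (simp only: prod)
  also have "\<dots> = (\<Sum>x\<in>UNIV. \<Sum>k\<in>UNIV. \<Sum>y\<in>UNIV. (a x * cnj (a y)) * \<psi> (k * (x - y)))"
    by (rule sum.swap)
  also have "\<dots> = (\<Sum>x\<in>UNIV. \<Sum>y\<in>UNIV. \<Sum>k\<in>UNIV. (a x * cnj (a y)) * \<psi> (k * (x - y)))"
    by (intro sum.cong refl sum.swap)
  also have "\<dots> = (\<Sum>x\<in>UNIV. \<Sum>y\<in>UNIV. if x = y then a x * cnj (a y) * of_nat CARD('a) else 0)"
    by (intro sum.cong refl)
      (simp add: sum_additive_character [OF assms] flip: sum_distrib_left)
  also have "\<dots> = complex_of_real (real CARD('a) * (\<Sum>x\<in>UNIV. (cmod (a x))\<^sup>2))"
    by (simp add: sum_distrib_left mult_ac flip: complex_norm_square)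
  finally show ?thesis
    using of_real_eq_iff by blast
qed

section \<open>Roots of unity and their distance from -1\<close>

lemma root_of_unity_eq_cis:
  fixes z :: complex
  assumes "z ^ p = 1" "p > 0"
  obtains j where "j < p" "z = cis (2 * pi * real j / real p)"
  using assms Complex.bij_betw_roots_unity [of p] unfolding bij_betw_def by blast

text \<open>As \<open>p\<close> is prime, the exponent \<open>j\<close> of a nontrivial root is
  invertible modulo \<open>p\<close>; with \<open>n\<close> its inverse, \<open>z ^ n\<close> is the
  standard primitive root.\<close>

lemma root_of_unity_powers:
  fixes z w :: complex
  assumes p: "prime p" and z: "z ^ p = 1" "z \<noteq> 1" and w: "w ^ p = 1"
  shows "\<exists>n. w = z ^ n"
proof -
  have p1: "p > 1" using p prime_gt_1_nat by blast
  obtain j where j: "j < p" "z = cis (2 * pi * real j / real p)"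
    using root_of_unity_eq_cis [OF z(1)] p1 by (metis less_trans zero_less_one)
  obtain k where k: "k < p" "w = cis (2 * pi * real k / real p)"
    using root_of_unity_eq_cis [OF w] p1 by (metis less_trans zero_less_one)
  have "j \<noteq> 0"
  proof
    assume "j = 0"
    then show False using j z by simp
  qed
  then have "coprime j p"
    using j p by (metis coprime_commute nat_dvd_not_less not_gr_zero prime_imp_coprime)
  then obtain n where n: "[j * n = 1] (mod p)"
    using cong_solve_coprime_nat by auto
  then have jn: "j * n = 1 + p * (j * n div p)"
    using p1 by (metis cong_def add.commute mod_less div_mult_mod_eq mult.commute)
  have "z ^ n = cis (2 * pi * real (j * n) / real p)"
    unfolding j(2) Complex.DeMoivre by (simp add: mult_ac)
  also have "2 * pi * real (j * n) / real p = 2 * pi / real p + 2 * pi * real (j * n div p)"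
    by (subst jn) (use p1 in \<open>simp add: field_simps\<close>)
  also have "cis \<dots> = cis (2 * pi / real p)"
    by (simp add: flip: cis_mult)
  finally have "z ^ (n * k) = w"
    unfolding power_mult k(2) by (simp add: Complex.DeMoivre field_simps)
  then show ?thesis by metis
qed

lemma cmod_1_plus_cis: "cmod (1 + cis \<theta>) = 2 * \<bar>cos (\<theta> / 2)\<bar>"
proof -
  have "(cmod (1 + cis \<theta>))\<^sup>2 = (1 + cos \<theta>)\<^sup>2 + (sin \<theta>)\<^sup>2"
    by (simp add: cmod_power2)
  also have "\<dots> = 2 + 2 * cos (2 * (\<theta> / 2))"
    using sin_cos_squared_add [of \<theta>] by (simp add: power2_eq_square algebra_simps)
  also have "\<dots> = (2 * \<bar>cos (\<theta> / 2)\<bar>)\<^sup>2"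
    by (subst cos_double_cos) (simp add: power_mult_distrib)
  finally show ?thesis
    by (rule power2_eq_imp_eq) simp_all
qed

text \<open>The modulus equals \<open>2 * \<bar>sin (pi * (p - 2 * j) / (2 * p))\<bar>\<close>.
  Since \<open>p\<close> is odd, \<open>p - 2 * j\<close> is a nonzero integer, of absolute value at
  most \<open>p\<close>; the angle thus lies, up to sign, between \<open>pi / (2 * p)\<close> and
  \<open>pi / 2\<close>, where the sine increases.\<close>

lemma cmod_1_plus_root_of_unity:
  fixes z :: complex
  assumes "z ^ p = 1" "odd p"
  shows "2 * sin (pi / (2 * real p)) \<le> cmod (1 + z)"
proof -
  have p: "p > 0" using assms(2) by (rule odd_pos)
  obtain j where j: "j < p" "z = cis (2 * pi * real j / real p)"
    using root_of_unity_eq_cis [OF assms(1) p] .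
  have ne: "2 * j \<noteq> p" using assms(2) by auto
  have "sin (pi / (2 * real p)) \<le> sin (pi * \<bar>real p - 2 * real j\<bar> / (2 * real p))"
  proof (rule sin_monotone_2pi_le)
    show "- (pi / 2) \<le> pi / (2 * real p)"
      by (rule order_trans [of _ 0]) simp_all
    have "1 \<le> \<bar>int p - 2 * int j\<bar>" using ne by linarith
    then have "real_of_int 1 \<le> real_of_int \<bar>int p - 2 * int j\<bar>"
      by (simp only: of_int_le_iff)
    then show "pi / (2 * real p) \<le> pi * \<bar>real p - 2 * real j\<bar> / (2 * real p)"
      using p by (intro divide_right_mono) auto
    have "\<bar>real p - 2 * real j\<bar> \<le> real p" using j by linarith
    then show "pi * \<bar>real p - 2 * real j\<bar> / (2 * real p) \<le> pi / 2"
      using p by (simp add: field_simps)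
  qed
  also have "\<dots> \<le> \<bar>sin (pi * (real p - 2 * real j) / (2 * real p))\<bar>"
  proof -
    let ?\<theta> = "pi * (real p - 2 * real j) / (2 * real p)"
    have "pi * \<bar>real p - 2 * real j\<bar> / (2 * real p) = \<bar>?\<theta>\<bar>"
      by (simp only: abs_mult abs_divide) simp
    moreover have "sin \<bar>?\<theta>\<bar> \<le> \<bar>sin ?\<theta>\<bar>"
      by (cases "?\<theta> \<ge> 0") (simp_all only: abs_of_nonneg abs_of_neg not_le sin_minus abs_ge_self abs_ge_minus_self)
    ultimately show ?thesis by (simp only:)
  qed
  also have "pi * (real p - 2 * real j) / (2 * real p) = pi / 2 - (2 * pi * real j / real p) / 2"
    using p by (simp add: field_simps)
  also have "sin \<dots> = cos ((2 * pi * real j / real p) / 2)"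
    by (simp add: cos_sin_eq)
  finally show ?thesis
    by (simp add: j cmod_1_plus_cis)
qed

text \<open>The Fourier transform diagonalises the translation by \<open>t\<close>, and each
  eigenvalue \<open>1 + \<psi> (k * t)\<close> has modulus at least \<open>2 * ?s\<close>. For
  \<open>t \<noteq> 0\<close> this bounds the vertex-edge incidence matrix of all cycles of the
  translation at once.\<close>

lemma translation_lower_bound:
  fixes \<psi> a :: "'a :: {field, finite} \<Rightarrow> complex"
  assumes \<psi>: "nontrivial_additive_character \<psi>" and p: "of_nat p = (0 :: 'a)" "odd p"
  shows "4 * (sin (pi / (2 * real p)))\<^sup>2 * (\<Sum>x\<in>UNIV. (cmod (a x))\<^sup>2)
    \<le> (\<Sum>x\<in>UNIV. (cmod (a x + a (x - t)))\<^sup>2)"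
proof -
  let ?s = "sin (pi / (2 * real p))"
  have ch: "additive_character \<psi>"
    using \<psi> by (simp add: nontrivial_additive_character_def)
  have s: "0 \<le> ?s"
    using p(2) odd_pos [OF p(2)] by (intro sin_ge_zero) (auto simp: field_simps)
  have four: "(\<Sum>x\<in>UNIV. (a x + a (x - t)) * \<psi> (k * x)) = (1 + \<psi> (k * t)) * (\<Sum>x\<in>UNIV. a x * \<psi> (k * x))" for k
  proof -
    have "(\<Sum>x\<in>UNIV. a (x - t) * \<psi> (k * x)) = (\<Sum>x\<in>UNIV. a (x + t - t) * \<psi> (k * (x + t)))"
      by (rule sum.reindex_bij_betw [symmetric], rule bij_betwI [of _ _ _ "\<lambda>x. x - t"]) auto
    also have "\<dots> = \<psi> (k * t) * (\<Sum>x\<in>UNIV. a x * \<psi> (k * x))"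
      using ch by (simp add: distrib_left additive_character_def sum_distrib_left mult_ac)
    finally show ?thesis
      by (simp add: distrib_right sum.distrib)
  qed
  have root: "2 * ?s \<le> cmod (1 + \<psi> (k * t))" for k
  proof (rule cmod_1_plus_root_of_unity [OF _ p(2)])
    show "\<psi> (k * t) ^ p = 1"
      using additive_character_of_nat [OF ch, of p "k * t"] additive_character_0 [OF ch] p by simp
  qed
  have "real CARD('a) * (4 * ?s\<^sup>2 * (\<Sum>x\<in>UNIV. (cmod (a x))\<^sup>2))
      = (\<Sum>k\<in>UNIV. (2 * ?s)\<^sup>2 * (cmod (\<Sum>x\<in>UNIV. a x * \<psi> (k * x)))\<^sup>2)"
    by (simp add: parseval_additive_character [OF \<psi>] power_mult_distrib flip: sum_distrib_left)
  also have "\<dots> \<le> (\<Sum>k\<in>UNIV. (cmod (1 + \<psi> (k * t)))\<^sup>2 * (cmod (\<Sum>x\<in>UNIV. a x * \<psi> (k * x)))\<^sup>2)"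
    using root s by (intro sum_mono mult_right_mono power_mono) auto
  also have "\<dots> = (\<Sum>k\<in>UNIV. (cmod (\<Sum>x\<in>UNIV. (a x + a (x - t)) * \<psi> (k * x)))\<^sup>2)"
    by (simp add: four norm_mult power_mult_distrib)
  also have "\<dots> = real CARD('a) * (\<Sum>x\<in>UNIV. (cmod (a x + a (x - t)))\<^sup>2)"
    by (rule parseval_additive_character [OF \<psi>])
  finally show ?thesis by simp
qed

section \<open>Values and kernel of a character in characteristic p\<close>

lemma prime_power_field_CHAR:
  assumes "prime p" "CARD('a :: {field, finite}) = p ^ h"
  shows "of_nat p = (0 :: 'a)"
proof -
  have "prime CHAR('a)"
    by (rule prime_CHAR_semidom) (simp add: finite_imp_CHAR_pos)
  moreover have "CHAR('a) dvd p ^ h"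
  proof -
    \<comment> \<open>Translating by \<open>1\<close> permutes the field, so adding \<open>1\<close>
      to each of the \<open>q\<close> summands changes nothing: \<open>q\<close> is zero in the
      field.\<close>
    have "(\<Sum>x\<in>UNIV. x + 1) = (\<Sum>x\<in>UNIV. x :: 'a)"
      by (rule sum.reindex_bij_betw, rule bij_betwI [of _ _ _ "\<lambda>x. x - 1"]) auto
    then have "of_nat CARD('a) = (0 :: 'a)"
      by (simp add: sum.distrib)
    then show ?thesis
      using assms by (metis of_nat_eq_0_iff_char_dvd)
  qed
  ultimately have "CHAR('a) = p"
    using assms(1) by (metis prime_dvd_power primes_dvd_imp_eq)
  then show ?thesis by (metis of_nat_CHAR)
qed

lemma additive_character_surj:
  fixes \<psi> :: "'a :: {field, finite} \<Rightarrow> complex"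
  assumes \<psi>: "nontrivial_additive_character \<psi>" and p: "of_nat p = (0 :: 'a)" "prime p"
    and w: "w ^ p = 1"
  shows "\<exists>y. \<psi> y = w"
proof -
  from \<psi> obtain x0 where x0: "\<psi> x0 \<noteq> 1" and ch: "additive_character \<psi>"
    by (auto simp: nontrivial_additive_character_def)
  have "\<psi> x0 ^ p = 1"
    using additive_character_of_nat [OF ch, of p x0] additive_character_0 [OF ch] p by simp
  from root_of_unity_powers [OF p(2) this x0 w] show ?thesis
    using additive_character_of_nat [OF ch] by metis
qed

text \<open>Pigeonhole: all values are \<open>p\<close>-th roots of unity, so at most
  \<open>p\<close> of them occur on more than \<open>p\<close> elements. The element
  \<open>z\<close> later yields a second frequency with the same character value at
  \<open>1\<close>.\<close>

lemma additive_character_kernel: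
  fixes \<psi> :: "'a :: {field, finite} \<Rightarrow> complex"
  assumes ch: "additive_character \<psi>" and p: "of_nat p = (0 :: 'a)" "0 < p" "p < CARD('a)"
  shows "\<exists>z. z \<noteq> 0 \<and> \<psi> z = 1"
proof -
  have "\<psi> ` UNIV \<subseteq> {z. z ^ p = 1}"
    using additive_character_of_nat [OF ch, of p] additive_character_0 [OF ch] p by auto
  then have "card (\<psi> ` UNIV) \<le> p"
    using card_mono [OF finite_roots_unity] card_roots_unity_eq [OF p(2)] p
    by (metis Suc_leI One_nat_def)
  then have "\<not> inj \<psi>"
    using p(3) card_image by fastforce
  then obtain x y where xy: "\<psi> x = \<psi> y" "x \<noteq> y"
    by (auto simp: inj_def)
  have "\<psi> (x - y) = \<psi> x * \<psi> (- y)"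
    using ch unfolding additive_character_def by (metis diff_conv_add_uminus)
  also have "\<dots> = \<psi> (y + - y)"
    using ch xy unfolding additive_character_def by metis
  finally show ?thesis
    using xy additive_character_0 [OF ch] by (intro exI [of _ "x - y"]) simp
qed


section \<open>The measurement norm\<close>

lemma bij_betw_of_nz: "bij_betw of_nz UNIV (- {0})"
  by (rule bij_betwI [of _ _ _ to_nz]) (auto simp: of_nz_inverse)

lemma sum_of_nz:
  fixes f :: "'a :: {field, finite} \<Rightarrow> 'b :: comm_monoid_add"
  shows "(\<Sum>m\<in>UNIV. f (of_nz m)) = (\<Sum>x\<in>- {0}. f x)"
  by (rule sum.reindex_bij_betw [OF bij_betw_of_nz])

lemma bij_mult_nz:
  fixes m :: "'a :: {field, finite} nz"
  shows "bij (\<lambda>l. l * m)"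
proof -
  have "inj (\<lambda>l. l * m)"
    by (simp add: inj_def nz_eq_iff)
  then show ?thesis
    by (simp add: bij_def finite_UNIV_inj_surj)
qed

lemma norm_vec_squared: "(norm v)\<^sup>2 = (\<Sum>i\<in>UNIV. (norm (v $ i))\<^sup>2)"
  by (simp add: norm_vec_def L2_set_def sum_nonneg)

lemma norm_matrix_squared:
  fixes A :: "complex ^ 'n ^ 'm"
  shows "(norm A)\<^sup>2 = (\<Sum>m\<in>UNIV. \<Sum>n\<in>UNIV. (cmod (A $ m $ n))\<^sup>2)"
  by (simp add: norm_vec_squared)

text \<open>Extension by zero lets translations and the Fourier transform act on each diagonal. The
  guard keeps the unspecified \<open>to_nz 0\<close> out.\<close>

definition zero_extend :: "complex ^ 'a nz ^ 'a nz \<Rightarrow> 'a :: {field, finite} \<Rightarrow> 'a \<Rightarrow> complex" where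
  "zero_extend A x y = (if x = 0 \<or> y = 0 then 0 else A $ to_nz x $ to_nz y)"

lemma zero_extend_0 [simp]: "zero_extend A 0 y = 0" "zero_extend A x 0 = 0"
  by (simp_all add: zero_extend_def)

lemma zero_extend_of_nz [simp]: "zero_extend A (of_nz m) (of_nz n) = A $ m $ n"
  by (simp add: zero_extend_def of_nz_inverse)

lemma sum_shear:
  fixes f :: "'a :: {field, finite} \<Rightarrow> 'a \<Rightarrow> 'b :: comm_monoid_add"
  shows "(\<Sum>x\<in>UNIV. \<Sum>y\<in>UNIV. f x y) = (\<Sum>t\<in>UNIV. \<Sum>x\<in>UNIV. f x (x + t))"
proof -
  have "(\<Sum>y\<in>UNIV. f x y) = (\<Sum>t\<in>UNIV. f x (x + t))" for x
    by (rule sum.reindex_bij_betw [symmetric], rule bij_betwI [of _ _ _ "\<lambda>y. y - x"]) auto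
  then have "(\<Sum>x\<in>UNIV. \<Sum>y\<in>UNIV. f x y) = (\<Sum>x\<in>UNIV. \<Sum>t\<in>UNIV. f x (x + t))"
    by (rule sum.cong [OF refl])
  also have "\<dots> = (\<Sum>t\<in>UNIV. \<Sum>x\<in>UNIV. f x (x + t))"
    by (rule sum.swap)
  finally show ?thesis .
qed

lemma sum_nz_shear:
  fixes f :: "'a :: {field, finite} \<Rightarrow> 'a \<Rightarrow> 'b :: comm_monoid_add"
  assumes "\<And>x. f x 0 = 0" "\<And>y. f 0 y = 0"
  shows "(\<Sum>m\<in>UNIV. \<Sum>n\<in>UNIV. f (of_nz m) (of_nz n)) = (\<Sum>t\<in>UNIV. \<Sum>x\<in>UNIV. f x (x + t))"
proof -
  have "(\<Sum>m\<in>UNIV. \<Sum>n\<in>UNIV. f (of_nz m) (of_nz n)) = (\<Sum>x\<in>- {0}. \<Sum>y\<in>- {0}. f x y)"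
    by (simp only: sum_of_nz [of "f _"] sum_of_nz [of "\<lambda>x. \<Sum>y\<in>- {0}. f x y"])
  also have "\<dots> = (\<Sum>x\<in>- {0}. \<Sum>y\<in>UNIV. f x y)"
    using assms by (intro sum.cong refl sum.mono_neutral_left) auto
  also have "\<dots> = (\<Sum>x\<in>UNIV. \<Sum>y\<in>UNIV. f x y)"
    using assms by (intro sum.mono_neutral_left) auto
  also have "\<dots> = (\<Sum>t\<in>UNIV. \<Sum>x\<in>UNIV. f x (x + t))"
    by (rule sum_shear)
  finally show ?thesis .
qed

lemma norm_matrix_zero_extend:
  "(norm A)\<^sup>2 = (\<Sum>t\<in>UNIV. \<Sum>x\<in>UNIV. (cmod (zero_extend A x (x + t)))\<^sup>2)"
proof -
  have "(norm A)\<^sup>2 = (\<Sum>m\<in>UNIV. \<Sum>n\<in>UNIV. (cmod (zero_extend A (of_nz m) (of_nz n)))\<^sup>2)"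
    unfolding zero_extend_of_nz by (rule norm_matrix_squared)
  also have "\<dots> = (\<Sum>t\<in>UNIV. \<Sum>x\<in>UNIV. (cmod (zero_extend A x (x + t)))\<^sup>2)"
    by (rule sum_nz_shear [of "\<lambda>x y. (cmod (zero_extend A x y))\<^sup>2"]) simp_all
  finally show ?thesis .
qed

text \<open>The parameter \<open>k\<close> enters only through the difference of the two indices,
  which is why the Fourier transform in \<open>k\<close> separates diagonals; \<open>l\<close> only
  dilates the window.\<close>

lemma measurement_map_eq:
  assumes "additive_character \<psi>"
  shows "measurement_map \<psi> (complex_vec \<phi>) A $ (k, l) =
    (\<Sum>m\<in>UNIV. \<Sum>n\<in>UNIV. A $ m $ n * complex_of_real (\<phi> $ (l * m) * \<phi> $ (l * n)) *
      \<psi> (k * (of_nz n - of_nz m)))"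
proof -
  have "\<psi> (k * (of_nz n - of_nz m)) = \<psi> (k * of_nz n) * \<psi> (- (k * of_nz m))" for m n
    using assms unfolding additive_character_def
    by (metis right_diff_distrib diff_conv_add_uminus)
  then show ?thesis
    by (simp add: measurement_map_def hermitian_def affine_rep_def matrix_vector_mult_def
        complex_vec_def cnj_additive_character [OF assms] sum_distrib_right sum_distrib_left mult_ac)
qed

text \<open>Parseval in \<open>k\<close> decouples the diagonals \<open>n - m = t\<close> of the matrix. The window is read
  through an arbitrary extension \<open>P\<close> to the whole field, as \<open>zero_extend A\<close> vanishes at \<open>0\<close>.\<close>

lemma norm_measurement_map:
  fixes \<psi> :: "'a :: {field, finite} \<Rightarrow> complex"
  assumes \<psi>: "nontrivial_additive_character \<psi>" and P: "\<And>m. \<phi> $ m = P (of_nz m)"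
  shows "(norm (measurement_map \<psi> (complex_vec \<phi>) A))\<^sup>2 =
    real CARD('a) * (\<Sum>l\<in>- {0}. \<Sum>t\<in>UNIV. (cmod (\<Sum>x\<in>UNIV.
      zero_extend A x (x + t) * complex_of_real (P (l * x) * P (l * (x + t)))))\<^sup>2)"
proof -
  have ch: "additive_character \<psi>"
    using \<psi> by (simp add: nontrivial_additive_character_def)
  let ?S = "\<lambda>l t. \<Sum>x\<in>UNIV. zero_extend A x (x + t) * complex_of_real (P (l * x) * P (l * (x + t)))"
  have M: "measurement_map \<psi> (complex_vec \<phi>) A $ (k, l) = (\<Sum>t\<in>UNIV. ?S (of_nz l) t * \<psi> (k * t))" for k l
  proof -
    have "measurement_map \<psi> (complex_vec \<phi>) A $ (k, l) = (\<Sum>m\<in>UNIV. \<Sum>n\<in>UNIV.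
        zero_extend A (of_nz m) (of_nz n) * complex_of_real (P (of_nz l * of_nz m) * P (of_nz l * of_nz n)) *
        \<psi> (k * (of_nz n - of_nz m)))"
      unfolding measurement_map_eq [OF ch] by (simp add: P)
    also have "\<dots> = (\<Sum>t\<in>UNIV. \<Sum>x\<in>UNIV. zero_extend A x (x + t) *
        complex_of_real (P (of_nz l * x) * P (of_nz l * (x + t))) * \<psi> (k * (x + t - x)))"
      by (rule sum_nz_shear) simp_all
    finally show ?thesis
      by (simp add: sum_distrib_right)
  qed
  have "(norm (measurement_map \<psi> (complex_vec \<phi>) A))\<^sup>2 =
      (\<Sum>k\<in>UNIV. \<Sum>l\<in>UNIV. (cmod (\<Sum>t\<in>UNIV. ?S (of_nz l) t * \<psi> (k * t)))\<^sup>2)"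
    unfolding norm_vec_squared sum.cartesian_product UNIV_Times_UNIV
    by (intro sum.cong refl) (auto simp only: M split_paired_all case_prod_conv)
  also have "\<dots> = (\<Sum>l\<in>UNIV. \<Sum>k\<in>UNIV. (cmod (\<Sum>t\<in>UNIV. ?S (of_nz l) t * \<psi> (k * t)))\<^sup>2)"
    by (rule sum.swap)
  also have "\<dots> = real CARD('a) * (\<Sum>l\<in>UNIV. \<Sum>t\<in>UNIV. (cmod (?S (of_nz l) t))\<^sup>2)"
    unfolding parseval_additive_character [OF \<psi>] by (rule sum_distrib_left [symmetric])
  also have "(\<Sum>l\<in>UNIV. \<Sum>t\<in>UNIV. (cmod (?S (of_nz l) t))\<^sup>2) = (\<Sum>l\<in>- {0}. \<Sum>t\<in>UNIV. (cmod (?S l t))\<^sup>2)"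
    by (rule sum_of_nz [of "\<lambda>l. \<Sum>t\<in>UNIV. (cmod (?S l t))\<^sup>2"])
  finally show ?thesis .
qed

lemma stability_nonneg: "0 \<le> stability \<psi> \<phi>"
  unfolding stability_def
  using sigma_min_attained(1) [OF linear_measurement_map, of \<psi> "complex_vec \<phi>"] by auto

lemma stability_mult_norm_le:
  "stability \<psi> \<phi> * norm A \<le> norm (measurement_map \<psi> (complex_vec \<phi>) A)"
proof (cases "A = 0")
  case False
  have "sigma_min (measurement_map \<psi> (complex_vec \<phi>)) \<le> norm (measurement_map \<psi> (complex_vec \<phi>) A) / norm A"
    by (rule sigma_min_attained(2) [OF linear_measurement_map False])
  moreover have "0 < norm A"
    using False by simp
  ultimately show ?thesis
    unfolding stability_def by (metis pos_le_divide_eq)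
qed simp

lemma stability_squared_le:
  "(stability \<psi> \<phi>)\<^sup>2 * (norm A)\<^sup>2 \<le> (norm (measurement_map \<psi> (complex_vec \<phi>) A))\<^sup>2"
  using power_mono [OF stability_mult_norm_le, of \<psi> \<phi> A 2] stability_nonneg [of \<psi> \<phi>]
  by (simp add: power_mult_distrib)

lemma le_stability_squared:
  assumes "\<And>A. c * (norm A)\<^sup>2 \<le> (norm (measurement_map \<psi> (complex_vec \<phi>) A))\<^sup>2"
  shows "c \<le> (stability \<psi> \<phi>)\<^sup>2"
proof -
  obtain A where A: "A \<noteq> 0" "stability \<psi> \<phi> = norm (measurement_map \<psi> (complex_vec \<phi>) A) / norm A"
    using sigma_min_attained(1) [OF linear_measurement_map, of \<psi> "complex_vec \<phi>"]
    unfolding stability_def by blast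
  then show ?thesis
    using assms [of A] by (simp add: power_divide pos_le_divide_eq)
qed


section \<open>The upper bounds\<close>

lemma sum_mult_nz:
  fixes f :: "'a :: {field, finite} nz \<Rightarrow> 'b :: comm_monoid_add"
  shows "(\<Sum>m\<in>UNIV. f (l * m)) = sum f UNIV"
  using sum.reindex_bij_betw [OF bij_mult_nz [of l], of f] by (simp add: mult.commute)

lemma fourth_moment_eq: "fourth_moment \<phi> = (\<Sum>m\<in>UNIV. ((\<phi> $ m)\<^sup>2)\<^sup>2)"
  by (simp add: fourth_moment_def flip: power_mult)

text \<open>The test matrix is the unit at \<open>(1, 1)\<close> minus its projection onto the
  identity. The identity is measured as the constant \<open>1\<close>, so removing it leaves the
  centred values \<open>(\<phi> $ l)\<^sup>2 - 1 / d\<close>, whose squares sum to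
  \<open>X - 1 / d\<close>.\<close>

lemma stability_squared_le_diagonal:
  fixes \<psi> :: "'a :: {field, finite} \<Rightarrow> complex" and \<phi> :: "real ^ 'a nz"
  assumes \<psi>: "additive_character \<psi>" and \<phi>: "norm \<phi> = 1" and d: "d = real CARD('a nz)" "d > 1"
  shows "(stability \<psi> \<phi>)\<^sup>2 * (d - 1) \<le> real CARD('a) * (d * fourth_moment \<phi> - 1)"
proof -
  define v :: "'a nz \<Rightarrow> real" where "v m = (if m = 1 then 1 else 0) - 1 / d" for m
  define A :: "complex ^ 'a nz ^ 'a nz" where
    "A = (\<chi> m n. if m = n then complex_of_real (v m) else 0)"
  have one: "(\<Sum>m\<in>UNIV. (\<phi> $ m)\<^sup>2) = 1"
    using \<phi> norm_vec_squared [of \<phi>] by simp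
  have "(cmod (A $ m $ n))\<^sup>2 = (if m = n then (v m)\<^sup>2 else 0)" for m n
    by (simp add: A_def)
  then have "(norm A)\<^sup>2 = (\<Sum>m\<in>UNIV. (v m)\<^sup>2)"
    by (simp add: norm_matrix_squared)
  also have "\<dots> = (\<Sum>m\<in>(UNIV :: 'a nz set). (if m = 1 then 1 - 2 / d else 0) + 1 / d\<^sup>2)"
    using d(2) by (intro sum.cong refl) (simp add: v_def power2_eq_square field_simps)
  also have "\<dots> = (d - 1) / d"
    using d(2) by (simp only: sum.distrib sum_constant d(1) [symmetric]) (simp add: power2_eq_square field_simps)
  finally have nA: "(norm A)\<^sup>2 = (d - 1) / d" .
  have M: "measurement_map \<psi> (complex_vec \<phi>) A $ (k, l) = complex_of_real ((\<phi> $ l)\<^sup>2 - 1 / d)" for k l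
  proof -
    have "measurement_map \<psi> (complex_vec \<phi>) A $ (k, l) =
        (\<Sum>m\<in>UNIV. \<Sum>n\<in>UNIV. if m = n then complex_of_real (v m * (\<phi> $ (l * m))\<^sup>2) else 0)"
      unfolding measurement_map_eq [OF \<psi>]
      by (intro sum.cong refl) (auto simp: A_def power2_eq_square additive_character_0 [OF \<psi>])
    also have "\<dots> = complex_of_real (\<Sum>m\<in>UNIV. v m * (\<phi> $ (l * m))\<^sup>2)"
      by simp
    also have "(\<Sum>m\<in>UNIV. v m * (\<phi> $ (l * m))\<^sup>2)
        = (\<Sum>m\<in>UNIV. (if m = 1 then (\<phi> $ (l * m))\<^sup>2 else 0) - (\<phi> $ (l * m))\<^sup>2 / d)"
      by (intro sum.cong refl) (simp add: v_def algebra_simps)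
    also have "\<dots> = (\<phi> $ l)\<^sup>2 - 1 / d"
      using sum_mult_nz [of "\<lambda>m. (\<phi> $ m)\<^sup>2" l] one
      by (simp add: sum_subtractf flip: sum_divide_distrib)
    finally show ?thesis .
  qed
  have "(norm (measurement_map \<psi> (complex_vec \<phi>) A))\<^sup>2
      = (\<Sum>k\<in>(UNIV :: 'a set). \<Sum>l\<in>UNIV. ((\<phi> $ l)\<^sup>2 - 1 / d)\<^sup>2)"
    unfolding norm_vec_squared sum.cartesian_product UNIV_Times_UNIV
    by (intro sum.cong refl) (auto simp only: M split_paired_all case_prod_conv norm_of_real power2_abs)
  also have "\<dots> = real CARD('a) * (\<Sum>l\<in>UNIV. ((\<phi> $ l)\<^sup>2)\<^sup>2 + 1 / d\<^sup>2 - 2 / d * (\<phi> $ l)\<^sup>2)"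
    by (simp add: power2_diff power_divide mult_ac)
  also have "\<dots> = real CARD('a) * (fourth_moment \<phi> - 1 / d)"
    using d(2)
    by (simp only: sum.distrib sum_subtractf fourth_moment_eq one d(1) [symmetric] sum_constant
        sum_distrib_left [symmetric]) (simp add: power2_eq_square field_simps)
  finally have "(stability \<psi> \<phi>)\<^sup>2 * ((d - 1) / d) \<le> real CARD('a) * (fourth_moment \<phi> - 1 / d)"
    using stability_squared_le [of \<psi> \<phi> A] nA by simp
  then have "(stability \<psi> \<phi>)\<^sup>2 * ((d - 1) / d) * d \<le> real CARD('a) * (fourth_moment \<phi> - 1 / d) * d"
    using d(2) by (intro mult_right_mono) auto
  moreover have "v * ((d - 1) / d) * d = v * (d - 1)" "v * (f - 1 / d) * d = v * (d * f - 1)" for v f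
    using d(2) by (simp_all add: field_simps)
  ultimately show ?thesis
    by (simp only:)
qed

lemma stability_squared_le_off_diagonal:
  fixes \<psi> :: "'a :: {field, finite} \<Rightarrow> complex" and \<phi> :: "real ^ 'a nz"
  assumes \<psi>: "additive_character \<psi>" and \<phi>: "norm \<phi> = 1" and d: "d = real CARD('a nz)" "d > 1"
  shows "(stability \<psi> \<phi>)\<^sup>2 * (d - 1) \<le> real CARD('a) * (1 - fourth_moment \<phi>)"
proof -
  have one: "(\<Sum>m\<in>UNIV. (\<phi> $ m)\<^sup>2) = 1"
    using \<phi> norm_vec_squared [of \<phi>] by simp
  have entry: "(stability \<psi> \<phi>)\<^sup>2
      \<le> real CARD('a) * (\<Sum>l\<in>UNIV. (\<phi> $ (l * m))\<^sup>2 * (\<phi> $ (l * n))\<^sup>2)" for m n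
  proof -
    define A :: "complex ^ 'a nz ^ 'a nz" where
      "A = (\<chi> i j. if i = m then (if j = n then 1 else 0) else 0)"
    have "(cmod (A $ i $ j))\<^sup>2 = (if i = m then (if j = n then 1 else 0) else 0)" for i j
      by (simp add: A_def)
    moreover have "(\<Sum>j\<in>UNIV. if i = m then (if j = n then 1 else 0) else 0) = (if i = m then 1 else (0::real))" for i
      by simp
    ultimately have nA: "(norm A)\<^sup>2 = 1"
      by (simp add: norm_matrix_squared)
    have M: "measurement_map \<psi> (complex_vec \<phi>) A $ (k, l) =
        complex_of_real (\<phi> $ (l * m) * \<phi> $ (l * n)) * \<psi> (k * (of_nz n - of_nz m))" for k l
    proof -
      have "A $ i $ j * x * y = (if i = m then if j = n then x * y else 0 else 0)" for i j x y
        by (simp add: A_def)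
      moreover have "(\<Sum>j\<in>UNIV. if i = m then f j else 0) = (if i = m then sum f UNIV else (0 :: complex))"
        for i and f :: "'a nz \<Rightarrow> complex"
        by (cases "i = m") simp_all
      ultimately show ?thesis
        by (simp only: measurement_map_eq [OF \<psi>] sum.delta sum.delta' finite UNIV_I if_True)
    qed
    have "cmod (\<psi> x) = 1" for x
      using \<psi> by (simp add: additive_character_def)
    then have "(cmod (measurement_map \<psi> (complex_vec \<phi>) A $ (k, l)))\<^sup>2
        = (\<phi> $ (l * m))\<^sup>2 * (\<phi> $ (l * n))\<^sup>2" for k l
      by (simp add: M norm_mult power_mult_distrib)
    then have "(norm (measurement_map \<psi> (complex_vec \<phi>) A))\<^sup>2
        = (\<Sum>k\<in>(UNIV :: 'a set). \<Sum>l\<in>UNIV. (\<phi> $ (l * m))\<^sup>2 * (\<phi> $ (l * n))\<^sup>2)"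
      unfolding norm_vec_squared sum.cartesian_product UNIV_Times_UNIV
      by (intro sum.cong refl) (auto simp only: split_paired_all case_prod_conv)
    then show ?thesis
      using stability_squared_le [of \<psi> \<phi> A] nA by simp
  qed
  \<comment> \<open>Multiplication by \<open>l\<close> permutes the entries of the unit vector, so
    for each \<open>l\<close> the sum over distinct pairs is the square of the total mass
    \<open>1\<close> minus the fourth moment.\<close>
  have inner: "(\<Sum>m\<in>UNIV. \<Sum>n\<in>UNIV - {m}. (\<phi> $ (l * m))\<^sup>2 * (\<phi> $ (l * n))\<^sup>2) = 1 - fourth_moment \<phi>" for l
  proof -
    have "(\<Sum>n\<in>UNIV - {m}. (\<phi> $ (l * n))\<^sup>2) = 1 - (\<phi> $ (l * m))\<^sup>2" for m
      using sum_mult_nz [of "\<lambda>m. (\<phi> $ m)\<^sup>2" l] one by (simp add: sum_diff1)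
    then have "(\<Sum>m\<in>UNIV. \<Sum>n\<in>UNIV - {m}. (\<phi> $ (l * m))\<^sup>2 * (\<phi> $ (l * n))\<^sup>2)
        = (\<Sum>m\<in>UNIV. (\<phi> $ (l * m))\<^sup>2 - ((\<phi> $ (l * m))\<^sup>2)\<^sup>2)"
      by (simp add: right_diff_distrib power2_eq_square flip: sum_distrib_left)
    then show ?thesis
      using sum_mult_nz [of "\<lambda>m. (\<phi> $ m)\<^sup>2 - ((\<phi> $ m)\<^sup>2)\<^sup>2" l] one
      by (simp add: sum_subtractf fourth_moment_eq)
  qed
  \<comment> \<open>There are \<open>d * (d - 1)\<close> ordered pairs of distinct indices; the
    bound of each matrix unit is added over all of them.\<close>
  have "(stability \<psi> \<phi>)\<^sup>2 * (d - 1) * d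
      = (\<Sum>m\<in>(UNIV :: 'a nz set). \<Sum>n\<in>UNIV - {m}. (stability \<psi> \<phi>)\<^sup>2)"
    using d by (simp add: card_Diff_singleton of_nat_diff)
  also have "\<dots> \<le> (\<Sum>m\<in>UNIV. \<Sum>n\<in>UNIV - {m}. real CARD('a) * (\<Sum>l\<in>UNIV. (\<phi> $ (l * m))\<^sup>2 * (\<phi> $ (l * n))\<^sup>2))"
    by (intro sum_mono entry)
  also have "\<dots> = real CARD('a) * (\<Sum>m\<in>UNIV. \<Sum>n\<in>UNIV - {m}. \<Sum>l\<in>UNIV. (\<phi> $ (l * m))\<^sup>2 * (\<phi> $ (l * n))\<^sup>2)"
    by (simp only: sum_distrib_left)
  also have "(\<Sum>m\<in>UNIV. \<Sum>n\<in>UNIV - {m}. \<Sum>l\<in>UNIV. (\<phi> $ (l * m))\<^sup>2 * (\<phi> $ (l * n))\<^sup>2)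
      = (\<Sum>m\<in>UNIV. \<Sum>l\<in>UNIV. \<Sum>n\<in>UNIV - {m}. (\<phi> $ (l * m))\<^sup>2 * (\<phi> $ (l * n))\<^sup>2)"
    by (intro sum.cong refl sum.swap)
  also have "\<dots> = (\<Sum>l\<in>UNIV. \<Sum>m\<in>UNIV. \<Sum>n\<in>UNIV - {m}. (\<phi> $ (l * m))\<^sup>2 * (\<phi> $ (l * n))\<^sup>2)"
    by (rule sum.swap)
  also have "\<dots> = d * (1 - fourth_moment \<phi>)"
    by (simp only: inner sum_constant d(1))
  finally have "((stability \<psi> \<phi>)\<^sup>2 * (d - 1)) * d \<le> (real CARD('a) * (1 - fourth_moment \<phi>)) * d"
    by (simp only: mult_ac)
  then show ?thesis
    using d(2) by simp
qed


section \<open>Two-level windows\<close>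

lemma sum_inverse_nonzero:
  fixes f :: "'a :: {field, finite} \<Rightarrow> 'b :: comm_monoid_add"
  shows "(\<Sum>l\<in>- {0}. f (inverse l)) = (\<Sum>u\<in>- {0}. f u)"
  by (rule sum.reindex_bij_betw, rule bij_betwI [of _ _ _ inverse]) auto

text \<open>For \<open>t \<noteq> 0\<close> the entries \<open>A(x, x + t)\<close> label the edges of the graph of the translation by \<open>t\<close>,
  and \<open>edge_sum\<close> adds the labels at the two edges meeting the vertex \<open>u\<close>.\<close>

definition edge_sum :: "complex ^ 'a nz ^ 'a nz \<Rightarrow> 'a :: {field, finite} \<Rightarrow> 'a \<Rightarrow> complex" where
  "edge_sum A t u = zero_extend A u (u + t) + (if t = 0 then 0 else zero_extend A (u - t) u)"

text \<open>The excess over \<open>1\<close> of the product of two rescaled window values at the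
  peak: on the main diagonal both factors are \<open>r\<close>, off it only one can be.\<close>

definition edge_weight :: "real \<Rightarrow> 'a :: zero \<Rightarrow> real" where
  "edge_weight r t = (if t = 0 then r\<^sup>2 - 1 else r - 1)"

text \<open>The window dilated by \<open>l\<close> has its peak at \<open>u = inverse l\<close>, so
  the group parameter becomes the vertex. The constant level of the window contributes the same
  total to every vertex; the peak contributes the edges at \<open>u\<close>.\<close>

lemma norm_measurement_map_two_level:
  fixes \<psi> :: "'a :: {field, finite} \<Rightarrow> complex"
  assumes \<psi>: "nontrivial_additive_character \<psi>"
    and c: "c = real CARD('a nz) - 1 + r\<^sup>2" "0 < c"
  shows "c\<^sup>2 * (norm (measurement_map \<psi> (complex_vec (two_level r)) A))\<^sup>2 =
    real CARD('a) * (\<Sum>t\<in>UNIV. \<Sum>u\<in>- {0}. (cmod ((\<Sum>x\<in>UNIV. zero_extend A x (x + t)) +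
      complex_of_real (edge_weight r t) * edge_sum A t u))\<^sup>2)"
proof -
  define P :: "'a \<Rightarrow> real" where "P x = (if x = 1 then r else 1) / sqrt c" for x
  let ?T = "\<lambda>l t. \<Sum>x\<in>UNIV. zero_extend A x (x + t) * complex_of_real (P (l * x) * P (l * (x + t)))"
  let ?R = "\<lambda>u t. (\<Sum>x\<in>UNIV. zero_extend A x (x + t)) + complex_of_real (edge_weight r t) * edge_sum A t u"
  have P: "two_level r $ m = P (of_nz m)" for m
    by (simp add: two_level_def Let_def P_def c(1) nz_eq_iff)
  have T: "complex_of_real c * ?T l t = ?R (inverse l) t" if l: "l \<noteq> 0" for l t
  proof -
    let ?u = "inverse l"
    have l1: "l * x = 1 \<longleftrightarrow> x = ?u" for x
      using l by (auto simp: field_simps)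
    have "c * (P a * P b) = (if a = 1 then r else 1) * (if b = 1 then r else 1)" for a b
    proof -
      have "c * (v / sqrt c * (v' / sqrt c)) = v * v'" for v v'
        using c(2) by (simp add: real_sqrt_mult_self [of c])
      then show ?thesis
        unfolding P_def .
    qed
    \<comment> \<open>For \<open>t \<noteq> 0\<close> the two peak conditions exclude each other, so
      there is no cross term; for \<open>t = 0\<close> they coincide and the second is switched off,
      lest the loop count twice.\<close>
    moreover have "(if x = ?u then r else 1) * (if x = ?u - t then r else 1) =
        1 + (if x = ?u then edge_weight r t else 0) + (if x = ?u - t then if t = 0 then 0 else edge_weight r t else 0)" for x
      by (auto simp: edge_weight_def power2_eq_square)
    ultimately have "c * (P (l * x) * P (l * (x + t))) =
        1 + (if x = ?u then edge_weight r t else 0) + (if x = ?u - t then if t = 0 then 0 else edge_weight r t else 0)" for x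
      by (simp only: l1 eq_diff_eq)
    then have "complex_of_real c * (zero_extend A x (x + t) * complex_of_real (P (l * x) * P (l * (x + t)))) =
        zero_extend A x (x + t) + (if x = ?u then edge_weight r t * zero_extend A x (x + t) else 0)
          + (if x = ?u - t then if t = 0 then 0 else edge_weight r t * zero_extend A x (x + t) else 0)" for x
      by (simp only: mult.left_commute [of "complex_of_real c"] flip: of_real_mult) (simp add: algebra_simps)
    then have "complex_of_real c * ?T l t = (\<Sum>x\<in>UNIV. zero_extend A x (x + t)
          + (if x = ?u then edge_weight r t * zero_extend A x (x + t) else 0)
          + (if x = ?u - t then if t = 0 then 0 else edge_weight r t * zero_extend A x (x + t) else 0))"
      by (simp only: sum_distrib_left)
    also have "\<dots> = ?R ?u t"
      by (simp add: sum.distrib edge_sum_def distrib_left)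
    finally show ?thesis .
  qed
  have cm: "c\<^sup>2 * (cmod z)\<^sup>2 = (cmod (complex_of_real c * z))\<^sup>2" for z
    by (simp add: norm_mult power_mult_distrib)
  have "c\<^sup>2 * (norm (measurement_map \<psi> (complex_vec (two_level r)) A))\<^sup>2 =
      real CARD('a) * (\<Sum>l\<in>- {0}. \<Sum>t\<in>UNIV. c\<^sup>2 * (cmod (?T l t))\<^sup>2)"
    unfolding norm_measurement_map [OF \<psi> P] by (simp only: sum_distrib_left mult.left_commute [of "c\<^sup>2"])
  also have "(\<Sum>l\<in>- {0}. \<Sum>t\<in>UNIV. c\<^sup>2 * (cmod (?T l t))\<^sup>2)
      = (\<Sum>l\<in>- {0}. \<Sum>t\<in>UNIV. (cmod (?R (inverse l) t))\<^sup>2)"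
    unfolding cm using T by (intro sum.cong refl) simp
  also have "\<dots> = (\<Sum>u\<in>- {0}. \<Sum>t\<in>UNIV. (cmod (?R u t))\<^sup>2)"
    by (rule sum_inverse_nonzero)
  also have "\<dots> = (\<Sum>t\<in>UNIV. \<Sum>u\<in>- {0}. (cmod (?R u t))\<^sup>2)"
    by (rule sum.swap)
  finally show ?thesis .
qed

text \<open>Summing the cross terms gives \<open>2 * w * \<kappa> * (cmod S)\<^sup>2\<close>, which
  is nonnegative. This is how the rank-one part is discarded.\<close>

lemma sum_cmod_plus_lower_bound:
  assumes "(\<Sum>u\<in>U. \<beta> u) = complex_of_real \<kappa> * S" "0 \<le> \<kappa>" "0 \<le> w"
  shows "w\<^sup>2 * (\<Sum>u\<in>U. (cmod (\<beta> u))\<^sup>2) \<le> (\<Sum>u\<in>U. (cmod (S + complex_of_real w * \<beta> u))\<^sup>2)"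
proof -
  have expand: "(cmod (S + complex_of_real w * b))\<^sup>2 = (cmod S)\<^sup>2 + 2 * w * Re (cnj S * b) + w\<^sup>2 * (cmod b)\<^sup>2" for b
    unfolding cmod_power2 by (simp add: power2_eq_square algebra_simps)
  have "Re (cnj S * (\<Sum>u\<in>U. \<beta> u)) = \<kappa> * (cmod S)\<^sup>2"
    unfolding assms(1) cmod_power2 by (simp add: power2_eq_square algebra_simps)
  then have "(\<Sum>u\<in>U. 2 * w * Re (cnj S * \<beta> u)) = 2 * w * (\<kappa> * (cmod S)\<^sup>2)"
    by (simp only: sum_distrib_left [symmetric] Re_sum [symmetric])
  also have "\<dots> \<ge> 0"
    using assms by simp
  finally have "0 \<le> (\<Sum>u\<in>U. 2 * w * Re (cnj S * \<beta> u))" .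
  moreover have "0 \<le> (\<Sum>u\<in>U. (cmod S)\<^sup>2)"
    by (simp add: sum_nonneg)
  ultimately show ?thesis
    by (simp add: expand sum.distrib sum_distrib_left)
qed

lemma sum_translate:
  fixes f :: "'a :: {field, finite} \<Rightarrow> 'b :: comm_monoid_add"
  shows "(\<Sum>u\<in>UNIV. f (u - t)) = sum f UNIV"
  by (rule sum.reindex_bij_betw, rule bij_betwI [of _ _ _ "\<lambda>u. u + t"]) auto

lemma edge_sum_0 [simp]: "edge_sum A t 0 = 0"
  by (simp add: edge_sum_def)

text \<open>Handshake count: an edge meets two vertices, a loop one. Leaving out the vertex
  \<open>0\<close> loses nothing, as the edges there carry \<open>0\<close>.\<close>

lemma sum_edge_sum:
  "(\<Sum>u\<in>- {0}. edge_sum A t u) = of_real (if t = 0 then 1 else 2) * (\<Sum>x\<in>UNIV. zero_extend A x (x + t))"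
proof -
  have "(\<Sum>u\<in>- {0}. edge_sum A t u) = (\<Sum>u\<in>UNIV. edge_sum A t u)"
    by (rule sum.mono_neutral_left) auto
  then show ?thesis
    using sum_translate [of "\<lambda>u. zero_extend A u (u + t)" t] by (simp add: edge_sum_def sum.distrib)
qed

lemma two_level_stability_lower:
  fixes \<psi> :: "'a :: {field, finite} \<Rightarrow> complex"
  assumes \<psi>: "nontrivial_additive_character \<psi>" and p: "of_nat p = (0 :: 'a)" "odd p"
    and c: "c = real CARD('a nz) - 1 + r\<^sup>2" "0 < c" and r: "1 \<le> r"
  shows "real CARD('a) * (2 * sin (pi / (2 * real p)) * (r - 1) / c)\<^sup>2 \<le> (stability \<psi> (two_level r))\<^sup>2"
proof (rule le_stability_squared)
  fix A :: "complex ^ 'a nz ^ 'a nz"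
  let ?s = "sin (pi / (2 * real p))"
  let ?S = "\<lambda>t. \<Sum>x\<in>UNIV. zero_extend A x (x + t)"
  have "(r - 1)\<^sup>2 * (4 * ?s\<^sup>2 * (\<Sum>x\<in>UNIV. (cmod (zero_extend A x (x + t)))\<^sup>2))
      \<le> (\<Sum>u\<in>- {0}. (cmod (?S t + complex_of_real (edge_weight r t) * edge_sum A t u))\<^sup>2)" for t
  proof -
    have "(r - 1)\<^sup>2 * (4 * ?s\<^sup>2 * (\<Sum>x\<in>UNIV. (cmod (zero_extend A x (x + t)))\<^sup>2))
        \<le> (edge_weight r t)\<^sup>2 * (\<Sum>u\<in>UNIV. (cmod (edge_sum A t u))\<^sup>2)"
    proof (cases "t = 0")
      case True
      \<comment> \<open>The main diagonal is never the worst block: its weight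
        \<open>r\<^sup>2 - 1\<close> has the extra factor \<open>r + 1 \<ge> 2\<close>, which
        exceeds \<open>2 * ?s\<close>.\<close>
      have "4 * ?s\<^sup>2 \<le> 2\<^sup>2"
        by (simp add: abs_square_le_1)
      also have "\<dots> \<le> (r + 1)\<^sup>2"
        using r by (intro power_mono) auto
      finally have "(r - 1)\<^sup>2 * (4 * ?s\<^sup>2) \<le> (r - 1)\<^sup>2 * (r + 1)\<^sup>2"
        by (intro mult_left_mono) auto
      also have "\<dots> = (r\<^sup>2 - 1)\<^sup>2"
        by (simp add: power2_eq_square algebra_simps)
      finally have "((r - 1)\<^sup>2 * (4 * ?s\<^sup>2)) * (\<Sum>x\<in>UNIV. (cmod (zero_extend A x (x + t)))\<^sup>2)
          \<le> (r\<^sup>2 - 1)\<^sup>2 * (\<Sum>x\<in>UNIV. (cmod (zero_extend A x (x + t)))\<^sup>2)"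
        by (intro mult_right_mono sum_nonneg) auto
      then show ?thesis
        using True by (simp add: edge_weight_def edge_sum_def mult_ac)
    next
      case False
      then show ?thesis
        using translation_lower_bound [OF \<psi> p, of "\<lambda>x. zero_extend A x (x + t)" t]
        by (intro mult_mono) (auto simp: edge_weight_def edge_sum_def sum_nonneg)
    qed
    also have "(\<Sum>u\<in>UNIV. (cmod (edge_sum A t u))\<^sup>2) = (\<Sum>u\<in>- {0}. (cmod (edge_sum A t u))\<^sup>2)"
      by (rule sum.mono_neutral_right) auto
    also have "(edge_weight r t)\<^sup>2 * \<dots>
        \<le> (\<Sum>u\<in>- {0}. (cmod (?S t + complex_of_real (edge_weight r t) * edge_sum A t u))\<^sup>2)"
      using r by (intro sum_cmod_plus_lower_bound [OF sum_edge_sum]) (auto simp: edge_weight_def)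
    finally show ?thesis .
  qed
  then have "(\<Sum>t\<in>UNIV. (r - 1)\<^sup>2 * (4 * ?s\<^sup>2 * (\<Sum>x\<in>UNIV. (cmod (zero_extend A x (x + t)))\<^sup>2)))
      \<le> (\<Sum>t\<in>UNIV. \<Sum>u\<in>- {0}. (cmod (?S t + complex_of_real (edge_weight r t) * edge_sum A t u))\<^sup>2)"
    by (rule sum_mono)
  then have "real CARD('a) * ((r - 1)\<^sup>2 * (4 * ?s\<^sup>2 * (norm A)\<^sup>2))
      \<le> c\<^sup>2 * (norm (measurement_map \<psi> (complex_vec (two_level r)) A))\<^sup>2"
    unfolding norm_measurement_map_two_level [OF \<psi> c] norm_matrix_zero_extend
    by (intro mult_left_mono) (simp_all add: sum_distrib_left)
  then show "real CARD('a) * (2 * ?s * (r - 1) / c)\<^sup>2 * (norm A)\<^sup>2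
      \<le> (norm (measurement_map \<psi> (complex_vec (two_level r)) A))\<^sup>2"
    using c(2) by (simp add: power_mult_distrib power_divide pos_divide_le_eq mult_ac)
qed

text \<open>The extremal edge labelling is a difference of two characters whose value at \<open>1\<close> is the
  \<open>p\<close>-th root of unity closest to \<open>-1\<close>; it vanishes on the prime field, hence does not use the
  edges at the missing vertex \<open>0\<close>. Two such characters exist as soon as \<open>q > p\<close>.\<close>

lemma two_level_stability_upper:
  fixes \<psi> :: "'a :: {field, finite} \<Rightarrow> complex"
  assumes \<psi>: "nontrivial_additive_character \<psi>" and p: "of_nat p = (0 :: 'a)" "odd p" "prime p" "p < CARD('a)"
    and c: "c = real CARD('a nz) - 1 + r\<^sup>2" "0 < c"
  shows "(stability \<psi> (two_level r))\<^sup>2 \<le> real CARD('a) * (2 * sin (pi / (2 * real p)) * (r - 1) / c)\<^sup>2"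
proof -
  let ?s = "sin (pi / (2 * real p))"
  have ch: "additive_character \<psi>"
    using \<psi> by (simp add: nontrivial_additive_character_def)
  have add: "\<psi> (x + y) = \<psi> x * \<psi> y" for x y
    using ch by (simp add: additive_character_def)
  have p3: "p \<ge> 3"
    using p(2,3) prime_ge_2_nat [OF p(3)] by (cases "p = 2") auto
  \<comment> \<open>Oddness of \<open>p\<close> gives \<open>w ^ p = - cis pi = 1\<close>.\<close>
  define w where "w = - cis (pi / real p)"
  have "w ^ p = 1"
    using p(2) p3 by (simp add: w_def Complex.DeMoivre)
  then obtain y where y: "\<psi> y = w"
    using additive_character_surj [OF \<psi> p(1,3)] by blast
  obtain z where z: "z \<noteq> 0" "\<psi> z = 1"
    using additive_character_kernel [OF ch p(1) _ p(4)] p3 by auto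
  have "cos (pi / real p) > 0"
    using p3 by (intro cos_gt_zero_pi) (auto simp: field_simps intro: less_le_trans [of _ 0])
  then have "w \<noteq> 1"
    by (auto simp: w_def complex_eq_iff)
  then have y0: "y \<noteq> 0" "y + z \<noteq> 0"
    using y z additive_character_0 [OF ch] add [of y z] by auto
  have w1: "cmod (1 + cnj w) = 2 * \<bar>?s\<bar>"
  proof -
    have "cmod (1 + cnj w) = cmod (cnj (1 + w))"
      by simp
    also have "\<dots> = cmod (1 + cis (pi / real p + pi))"
      by (simp only: complex_mod_cnj w_def minus_cis)
    also have "\<dots> = 2 * \<bar>cos (pi / (2 * real p) + pi / 2)\<bar>"
      by (simp add: cmod_1_plus_cis add_divide_distrib mult.commute)
    finally show ?thesis
      by (simp add: cos_add)
  qed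
  define \<alpha> where "\<alpha> x = \<psi> (x * y) - \<psi> (x * (y + z))" for x
  \<comment> \<open>Both frequencies give the value \<open>w\<close> at \<open>1\<close>, so
    \<open>\<alpha>\<close> is an eigenvector of the translation by \<open>1\<close>, and adding
    neighbouring labels multiplies it by \<open>1 + cnj w\<close>.\<close>
  have \<alpha>_shift: "\<alpha> (x - 1) = cnj w * \<alpha> x" for x
  proof -
    have shift: "\<psi> ((x - 1) * v) = \<psi> (x * v) * cnj (\<psi> v)" for v
      using add [of "x * v" "- v"] by (simp add: cnj_additive_character [OF ch] left_diff_distrib)
    show ?thesis
      unfolding \<alpha>_def shift add [of y z] y z(2) by (simp add: right_diff_distrib mult.commute)
  qed
  have \<alpha>_0: "\<alpha> 0 = 0"
    by (simp add: \<alpha>_def)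
  then have \<alpha>_m1: "\<alpha> (- 1) = 0"
    using \<alpha>_shift [of 0] by simp
  \<comment> \<open>Neither frequency is zero because \<open>w \<noteq> 1\<close>; hence the
    rank-one part vanishes on this labelling.\<close>
  have \<alpha>_sum: "(\<Sum>x\<in>UNIV. \<alpha> x) = 0"
    using y0 by (simp add: \<alpha>_def sum_subtractf sum_additive_character [OF \<psi>])
  \<comment> \<open>At \<open>x0 / z\<close> the two characters differ by the factor
    \<open>\<psi> x0\<close>, so \<open>\<alpha>\<close> does not vanish there.\<close>
  obtain x0 where x0: "\<psi> x0 \<noteq> 1"
    using \<psi> by (auto simp: nontrivial_additive_character_def)
  have "cmod (\<psi> ((x0 / z) * y)) = 1"
    using ch by (simp add: additive_character_def)
  then have "\<psi> ((x0 / z) * y) \<noteq> 0"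
    by auto
  then have \<alpha>_nz: "\<alpha> (x0 / z) \<noteq> 0"
    using x0 z(1) add [of "(x0 / z) * y" x0] by (simp add: \<alpha>_def distrib_left)
  define A :: "complex ^ 'a nz ^ 'a nz" where
    "A = (\<chi> m n. if of_nz n = of_nz m + 1 then \<alpha> (of_nz m) else 0)"
  \<comment> \<open>On the diagonal \<open>t = 1\<close> the edges at the missing vertex start at
    \<open>0\<close> and \<open>- 1\<close>, exactly where \<open>\<alpha>\<close> has been shown to
    vanish.\<close>
  have E: "zero_extend A x (x + t) = (if t = 1 then \<alpha> x else 0)" for x t
  proof (cases "x = 0 \<or> x + t = 0")
    case True
    then have "t = 1 \<Longrightarrow> x = 0 \<or> x = - 1"
      by (auto simp: eq_neg_iff_add_eq_0)
    then show ?thesis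
      using True \<alpha>_0 \<alpha>_m1 by (auto simp: zero_extend_def)
  next
    case False
    then show ?thesis
      by (simp add: zero_extend_def A_def)
  qed
  have E': "zero_extend A (x - t) x = (if t = 1 then \<alpha> (x - t) else 0)" for x t
    using E [of "x - t" t] by simp
  have edge: "edge_sum A t u = (if t = 1 then (1 + cnj w) * \<alpha> u else 0)" for t u
    by (simp add: edge_sum_def E E' \<alpha>_shift distrib_right)
  have S: "(\<Sum>x\<in>UNIV. zero_extend A x (x + t)) = 0" for t
    by (cases "t = 1") (simp_all add: E \<alpha>_sum)
  have "(cmod (zero_extend A x (x + t)))\<^sup>2 = (if t = 1 then (cmod (\<alpha> x))\<^sup>2 else 0)" for x t
    by (simp add: E)
  moreover have "(\<Sum>x\<in>UNIV. if t = 1 then (cmod (\<alpha> x))\<^sup>2 else 0) = (if t = 1 then \<Sum>x\<in>UNIV. (cmod (\<alpha> x))\<^sup>2 else 0)" for t :: 'a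
    by (cases "t = 1") simp_all
  ultimately have nA: "(norm A)\<^sup>2 = (\<Sum>x\<in>UNIV. (cmod (\<alpha> x))\<^sup>2)"
    by (simp add: norm_matrix_zero_extend)
  have "0 < (\<Sum>x\<in>UNIV. (cmod (\<alpha> x))\<^sup>2)"
    using \<alpha>_nz by (intro sum_pos2 [of _ "x0 / z"]) auto
  then have pos: "0 < (norm A)\<^sup>2"
    by (simp only: nA)
  have "(cmod (complex_of_real (edge_weight r t) * edge_sum A t u))\<^sup>2
      = (if t = 1 then (r - 1)\<^sup>2 * (4 * ?s\<^sup>2) * (cmod (\<alpha> u))\<^sup>2 else 0)" for t u
    by (simp add: edge edge_weight_def norm_mult power_mult_distrib w1)
  moreover have "(\<Sum>u\<in>- {0}. if t = 1 then (r - 1)\<^sup>2 * (4 * ?s\<^sup>2) * (cmod (\<alpha> u))\<^sup>2 else 0)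
      = (if t = 1 then \<Sum>u\<in>- {0}. (r - 1)\<^sup>2 * (4 * ?s\<^sup>2) * (cmod (\<alpha> u))\<^sup>2 else 0)" for t :: 'a
    by (cases "t = 1") simp_all
  ultimately have "c\<^sup>2 * (norm (measurement_map \<psi> (complex_vec (two_level r)) A))\<^sup>2
      = real CARD('a) * (\<Sum>u\<in>- {0}. (r - 1)\<^sup>2 * (4 * ?s\<^sup>2) * (cmod (\<alpha> u))\<^sup>2)"
    unfolding norm_measurement_map_two_level [OF \<psi> c] S by simp
  also have "\<dots> \<le> real CARD('a) * (\<Sum>u\<in>UNIV. (r - 1)\<^sup>2 * (4 * ?s\<^sup>2) * (cmod (\<alpha> u))\<^sup>2)"
    by (intro mult_left_mono sum_mono2) auto
  also have "\<dots> = real CARD('a) * ((r - 1)\<^sup>2 * (4 * ?s\<^sup>2)) * (norm A)\<^sup>2"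
    by (simp only: nA sum_distrib_left [symmetric] mult.assoc)
  finally have "c\<^sup>2 * ((stability \<psi> (two_level r))\<^sup>2 * (norm A)\<^sup>2)
      \<le> real CARD('a) * ((r - 1)\<^sup>2 * (4 * ?s\<^sup>2)) * (norm A)\<^sup>2"
    using mult_left_mono [OF stability_squared_le [of \<psi> "two_level r" A], of "c\<^sup>2"] by simp
  then have "(c\<^sup>2 * (stability \<psi> (two_level r))\<^sup>2) * (norm A)\<^sup>2
      \<le> (real CARD('a) * ((r - 1)\<^sup>2 * (4 * ?s\<^sup>2))) * (norm A)\<^sup>2"
    by (simp only: mult.assoc)
  then have "c\<^sup>2 * (stability \<psi> (two_level r))\<^sup>2 \<le> real CARD('a) * ((r - 1)\<^sup>2 * (4 * ?s\<^sup>2))"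
    using pos by (rule mult_right_le_imp_le)
  then show ?thesis
    using c(2) by (simp add: power_mult_distrib power_divide pos_le_divide_eq mult_ac)
qed

section \<open>Maximising over r and comparing with all real windows\<close>

lemma two_level_profile_le:
  fixes s r :: real
  assumes "3 \<le> s" "0 \<le> r"
  shows "\<bar>r - 1\<bar> / (s\<^sup>2 - 1 + r\<^sup>2) \<le> 1 / (2 * (s + 1))"
proof -
  have "2 * (s + 1) * \<bar>r - 1\<bar> \<le> s\<^sup>2 - 1 + r\<^sup>2"
  proof (cases "r \<ge> 1")
    case True
    \<comment> \<open>With \<open>s = sqrt d\<close> the square vanishes exactly at
      \<open>r = 1 + sqrt d\<close>, the origin of the optimal parameter.\<close>
    have "s\<^sup>2 - 1 + r\<^sup>2 - 2 * (s + 1) * (r - 1) = (s - (r - 1))\<^sup>2"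
      by (simp add: power2_eq_square algebra_simps)
    moreover have "\<bar>r - 1\<bar> = r - 1"
      using True by simp
    ultimately show ?thesis
      using zero_le_power2 [of "s - (r - 1)"] by linarith
  next
    case False
    have "2 * (s + 1) * \<bar>r - 1\<bar> \<le> 2 * (s + 1)"
      using False assms by (intro mult_left_le) auto
    \<comment> \<open>Here \<open>s \<ge> 3\<close>, that is \<open>d \<ge> 9\<close>, gives
      \<open>2 \<le> s - 1\<close>.\<close>
    also have "\<dots> \<le> (s - 1) * (s + 1)"
      using assms by (intro mult_right_mono) auto
    also have "\<dots> \<le> s\<^sup>2 - 1 + r\<^sup>2"
      by (simp add: power2_eq_square algebra_simps)
    finally show ?thesis .
  qed
  moreover have "3\<^sup>2 \<le> s\<^sup>2"
    using assms by (intro power_mono) auto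
  then have "9 \<le> s\<^sup>2"
    by simp
  then have "0 < s\<^sup>2 - 1 + r\<^sup>2"
    using zero_le_power2 [of r] by linarith
  ultimately show ?thesis
    using assms by (simp add: divide_simps mult_ac)
qed

text \<open>The upper bound on the stability holds for every \<open>r \<ge> 0\<close> and the
  matching lower bound for \<open>r \<ge> 1\<close>, so the lower one is needed only at the
  maximiser, where both equal \<open>B\<close>.\<close>

lemma two_level_optimal:
  fixes \<psi> :: "'a :: {field, finite} \<Rightarrow> complex"
  assumes \<psi>: "nontrivial_additive_character \<psi>" and p: "prime p" "odd p" "2 \<le> h" "CARD('a) = p ^ h"
    and d: "d = real CARD('a nz)" "9 \<le> d"
  defines "B \<equiv> sqrt (real CARD('a)) * sin (pi / (2 * real p)) / (sqrt d + 1)"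
  shows "0 \<le> r \<Longrightarrow> stability \<psi> (two_level r) \<le> B"
    and "stability \<psi> (two_level (1 + sqrt d)) \<ge> B"
proof -
  let ?s = "sin (pi / (2 * real p))"
  have p1: "p > 1"
    using p(1) by (rule prime_gt_1_nat)
  have p0: "of_nat p = (0 :: 'a)"
    using p by (intro prime_power_field_CHAR)
  have "p ^ 1 < p ^ h"
    using p1 p(3) by (intro power_strict_increasing) auto
  then have pq: "p < CARD('a)"
    using p(4) by simp
  have s0: "0 \<le> ?s"
    using p1 by (intro sin_ge_zero) (auto simp: field_simps)
  have "sqrt (3\<^sup>2) \<le> sqrt d"
    using d by (intro real_sqrt_le_mono) simp
  then have sd: "3 \<le> sqrt d"
    by simp
  have B0: "0 \<le> B"
    using s0 sd by (simp add: B_def)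
  have B2: "B\<^sup>2 = real CARD('a) * (?s / (sqrt d + 1))\<^sup>2"
    by (simp add: B_def power_mult_distrib power_divide)
  have d': "d = (sqrt d)\<^sup>2"
    using d by simp
  show "stability \<psi> (two_level r) \<le> B" if r: "0 \<le> r"
  proof -
    let ?c = "real CARD('a nz) - 1 + r\<^sup>2"
    have c: "0 < ?c"
      using d zero_le_power2 [of r] by linarith
    have "\<bar>r - 1\<bar> / ?c \<le> 1 / (2 * (sqrt d + 1))"
      using two_level_profile_le [OF sd r] d by simp
    then have "(2 * ?s) * (\<bar>r - 1\<bar> / ?c) \<le> (2 * ?s) * (1 / (2 * (sqrt d + 1)))"
      using s0 by (intro mult_left_mono) auto
    also have "\<dots> = ?s / (sqrt d + 1)"
      using sd by (simp add: field_simps)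
    also have "(2 * ?s) * (\<bar>r - 1\<bar> / ?c) = \<bar>2 * ?s * (r - 1) / ?c\<bar>"
      using s0 c by (simp add: abs_mult)
    finally have "\<bar>2 * ?s * (r - 1) / ?c\<bar> \<le> ?s / (sqrt d + 1)" .
    then have "\<bar>2 * ?s * (r - 1) / ?c\<bar>\<^sup>2 \<le> (?s / (sqrt d + 1))\<^sup>2"
      by (intro power_mono) auto
    then have "real CARD('a) * (2 * ?s * (r - 1) / ?c)\<^sup>2 \<le> B\<^sup>2"
      unfolding B2 power2_abs by (intro mult_left_mono) auto
    then have "(stability \<psi> (two_level r))\<^sup>2 \<le> B\<^sup>2"
      using two_level_stability_upper [OF \<psi> p0 p(2,1) pq refl c] by linarith
    then show ?thesis
      using B0 by (rule power2_le_imp_le)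
  qed
  let ?c = "real CARD('a nz) - 1 + (1 + sqrt d)\<^sup>2"
  \<comment> \<open>The factor \<open>sqrt d\<close> cancels against
    \<open>r - 1 = sqrt d\<close>.\<close>
  have c: "?c = 2 * sqrt d * (sqrt d + 1)"
    using d by (simp add: power2_eq_square algebra_simps)
  have c0: "0 < ?c"
    unfolding c using sd by (intro mult_pos_pos) linarith+
  have "2 * ?s * (1 + sqrt d - 1) / ?c = ?s / (sqrt d + 1)"
  proof -
    have "2 * a * (1 + b - 1) / (2 * b * (b + 1)) = a / (b + 1)" if "3 \<le> b" for a b :: real
      using that by (simp add: divide_simps)
    then show ?thesis
      unfolding c using sd by blast
  qed
  then have "B\<^sup>2 \<le> (stability \<psi> (two_level (1 + sqrt d)))\<^sup>2"
    using two_level_stability_lower [OF \<psi> p0 p(2) refl c0] d unfolding B2 by simp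
  then show "B \<le> stability \<psi> (two_level (1 + sqrt d))"
    using stability_nonneg by (rule power2_le_imp_le)
qed

text \<open>Both summands of the numerator are at most \<open>sqrt q\<close>, which cancels and
  leaves a bound in \<open>p\<close> alone.\<close>

lemma optimality_factor_le:
  assumes "prime p" "odd p"
  shows "optimality_factor p (p ^ h) \<le> 2 / sin (pi / (2 * real p))"
proof -
  have p1: "p > 1"
    using assms(1) by (rule prime_gt_1_nat)
  have s: "0 < sin (pi / (2 * real p))"
    using p1 by (intro sin_gt_zero) (auto simp: field_simps)
  have q: "1 \<le> real (p ^ h)"
    using p1 by simp
  have "sqrt (real (p ^ h) - 1) + 1 \<le> 2 * sqrt (real (p ^ h))"
  proof -
    have "sqrt (real (p ^ h) - 1) \<le> sqrt (real (p ^ h))"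
      by (rule real_sqrt_le_mono) simp
    moreover have "1 \<le> sqrt (real (p ^ h))"
      using q by simp
    ultimately show ?thesis by linarith
  qed
  then have "optimality_factor p (p ^ h) \<le> (2 * sqrt (real (p ^ h))) / (sqrt (real (p ^ h)) * sin (pi / (2 * real p)))"
    unfolding optimality_factor_def using s q by (intro divide_right_mono) auto
  also have "\<dots> = 2 / sin (pi / (2 * real p))"
    using q by (simp del: of_nat_power)
  finally show ?thesis .
qed

theorem theorem6p22:
  fixes \<psi> :: "'a :: {field, finite} \<Rightarrow> complex" and q d :: nat
  assumes q: "q = CARD('a)" "odd q"
    and d: "d = q - 1"
    and \<psi>: "nontrivial_additive_character \<psi>"
  shows
    "(\<forall>\<phi> :: real ^ 'a nz. norm \<phi> = 1 \<longrightarrow>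
        (let X = fourth_moment \<phi>;
             \<mu> = min ((real d * X - 1) / (real d - 1)) ((1 - X) / (real d - 1))
         in (stability \<psi> \<phi>)\<^sup>2 \<le> real q * \<mu> \<and> \<mu> \<le> 1 / real q \<and> (stability \<psi> \<phi>)\<^sup>2 \<le> 1)) \<and>
     (\<forall>p h. prime p \<and> odd p \<and> h \<ge> 2 \<and> q = p ^ h \<and> d \<ge> 10 \<longrightarrow>
        is_arg_max (\<lambda>r. stability \<psi> (two_level r)) (\<lambda>r. r \<ge> 0) (1 + sqrt (real d)) \<and>
        (SUP \<phi>\<in>{\<phi> :: real ^ 'a nz. norm \<phi> = 1}. stability \<psi> \<phi>)
          \<le> optimality_factor p q * stability \<psi> (two_level (1 + sqrt (real d)))) \<and>
     (\<forall>p :: nat. prime p \<and> odd p \<longrightarrow> (\<exists>C. \<forall>h\<ge>2. optimality_factor p (p ^ h) \<le> C))"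
proof -
  have ch: "additive_character \<psi>"
    using \<psi> by (simp add: nontrivial_additive_character_def)
  \<comment> \<open>A field has at least two elements, so an odd \<open>q\<close> is at least
    \<open>3\<close>, and the denominator \<open>d - 1\<close> is positive.\<close>
  have "card {0, 1 :: 'a} \<le> CARD('a)"
    by (rule card_mono) auto
  then have "q \<ge> 3"
    using q by (cases "q = 2") auto
  then have dq: "real d = real CARD('a nz)" "real d > 1" "real q = real d + 1"
    using d q(1) by (simp_all add: card_nz)
  have first: "(stability \<psi> \<phi>)\<^sup>2 \<le> real q * \<mu> \<and> \<mu> \<le> 1 / real q \<and> (stability \<psi> \<phi>)\<^sup>2 \<le> 1"
    if \<phi>: "norm \<phi> = 1"
      and \<mu>: "\<mu> = min ((real d * fourth_moment \<phi> - 1) / (real d - 1)) ((1 - fourth_moment \<phi>) / (real d - 1))"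
    for \<phi> :: "real ^ 'a nz" and \<mu>
  proof -
    have "(stability \<psi> \<phi>)\<^sup>2 \<le> real q * ((real d * fourth_moment \<phi> - 1) / (real d - 1))"
      using stability_squared_le_diagonal [OF ch \<phi> dq(1,2)] dq(2) q(1) by (simp add: pos_le_divide_eq)
    moreover have "(stability \<psi> \<phi>)\<^sup>2 \<le> real q * ((1 - fourth_moment \<phi>) / (real d - 1))"
      using stability_squared_le_off_diagonal [OF ch \<phi> dq(1,2)] dq(2) q(1) by (simp add: pos_le_divide_eq)
    ultimately have 1: "(stability \<psi> \<phi>)\<^sup>2 \<le> real q * \<mu>"
      unfolding \<mu> by (simp add: min_def)
    \<comment> \<open>The two entries of the minimum, weighted by \<open>1\<close> and \<open>d\<close>, add up to \<open>1\<close>.\<close>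
    have "\<mu> + real d * \<mu> \<le> (real d * fourth_moment \<phi> - 1) / (real d - 1)
        + real d * ((1 - fourth_moment \<phi>) / (real d - 1))"
      unfolding \<mu> by (intro add_mono mult_left_mono) auto
    also have "\<dots> = (real d - 1) / (real d - 1)"
      by (simp add: right_diff_distrib flip: add_divide_distrib)
    also have "\<dots> = 1"
      using dq(2) by simp
    finally have "real q * \<mu> \<le> 1"
      by (simp add: dq(3) algebra_simps)
    with 1 show ?thesis
      using dq by (simp add: pos_le_divide_eq mult.commute)
  qed
  have second: "is_arg_max (\<lambda>r. stability \<psi> (two_level r)) (\<lambda>r. r \<ge> 0) (1 + sqrt (real d)) \<and>
      (SUP \<phi>\<in>{\<phi> :: real ^ 'a nz. norm \<phi> = 1}. stability \<psi> \<phi>)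
        \<le> optimality_factor p q * stability \<psi> (two_level (1 + sqrt (real d)))"
    if p: "prime p" "odd p" "h \<ge> 2" "q = p ^ h" "d \<ge> 10" for p h
  proof
    let ?s = "sin (pi / (2 * real p))"
    let ?B = "sqrt (real CARD('a)) * ?s / (sqrt (real d) + 1)"
    have d9: "9 \<le> real d"
      using p(5) by simp
    have ph: "CARD('a) = p ^ h"
      using q(1) p(4) by simp
    note opt = two_level_optimal [OF \<psi> p(1-3) ph dq(1) d9]
    show "is_arg_max (\<lambda>r. stability \<psi> (two_level r)) (\<lambda>r. r \<ge> 0) (1 + sqrt (real d))"
      unfolding is_arg_max_def using opt by (fastforce simp: not_less intro: order_trans)
    have s: "0 < ?s"
      using prime_gt_1_nat [OF p(1)] by (intro sin_gt_zero) (auto simp: field_simps)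
    have "0 < sqrt (real d) + 1"
      by (simp add: add_nonneg_pos)
    \<comment> \<open>Multiplying the optimal value by the factor thus reaches \<open>1\<close>, the
      universal upper bound for all real unit windows.\<close>
    then have "optimality_factor p q * ?B = 1"
      using s dq by (simp add: optimality_factor_def q(1) [symmetric])
    moreover have "0 \<le> optimality_factor p q"
      using s dq by (simp add: optimality_factor_def)
    ultimately have "1 \<le> optimality_factor p q * stability \<psi> (two_level (1 + sqrt (real d)))"
      using mult_left_mono [OF opt(2), of "optimality_factor p q"] by (simp only:)
    moreover have "(SUP \<phi>\<in>{\<phi> :: real ^ 'a nz. norm \<phi> = 1}. stability \<psi> \<phi>) \<le> 1"
    proof (rule cSUP_least)
      show "{\<phi> :: real ^ 'a nz. norm \<phi> = 1} \<noteq> {}"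
        using norm_axis_1 by blast
      show "stability \<psi> \<phi> \<le> 1" if "\<phi> \<in> {\<phi>. norm \<phi> = 1}" for \<phi>
        using first [OF _ refl, of \<phi>] that by (simp add: abs_square_le_1 abs_le_iff)
    qed
    ultimately show "(SUP \<phi>\<in>{\<phi> :: real ^ 'a nz. norm \<phi> = 1}. stability \<psi> \<phi>)
        \<le> optimality_factor p q * stability \<psi> (two_level (1 + sqrt (real d)))"
      by linarith
  qed
  show ?thesis
    unfolding Let_def using first second optimality_factor_le by blast
qed

end
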